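(* Let $p\in(0,1/2)$. Probabilistically disoriented linear search with parameter $p$ and one agent admits a deterministic algorithm whose competitive ratio equals $2(\sqrt2+2)$ when $0<p\leq \frac14(2-\sqrt2)$, and equals $6-4p+\frac{1}{1-2p}$ when $\frac14(2-\sqrt2)<p<1/2$.
   Context: Probabilistically disoriented linear search with parameter $p$: a single agent starts at the origin of the real line and moves at speed at most $1$; changing direction costs no extra time. A hidden target is placed at an unknown point $x\in\mathbb{R}$; the agent detects the origin and the target when it walks over them. The agent is $p$-faulty: every attempt to change direction (including after stopping) fails independently with probability $p$ (the agent then keeps moving in the same direction), and the agent is not informed whether an attempt succeeded; it can only infer it from later observations such as visits to the origin. Initially the agent starts moving in a chosen direction without fault. A deterministic algorithm uses no randomness besides the faults. If $E(x)$ is the expected time at which target $x$ is reached, the competitive ratio is $\limsup_{|x|\to\infty} E(x)/|x|$. *)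

theory Defs
  imports "HOL-Probability.Probability"
begin

text \<open>
  The agent proceeds in legs. At the start of a leg it issues a command: optionally attempt to
  reverse the heading, then move along the current heading at constant speed for the
  given duration. A leg is cut short when the agent arrives at the origin. Speed 0 is waiting; a
  duration 0 allows several attempts at the same place.
\<close>

record command =
  attempt_turn :: bool
  speed :: real
  duration :: real

text \<open>
  What the agent learns from a leg is the time it took and whether it ended at the origin. In
  particular position, heading and the success of an attempt to turn are not observed.
\<close>

type_synonym observation = "real \<times> bool"

record algorithm =
  start_heading :: real
  decide :: "observation list \<Rightarrow> command"

definition admissible :: "algorithm \<Rightarrow> bool" where
  "admissible A \<longleftrightarrow>
     start_heading A \<in> {-1, 1} \<and>
     (\<forall>h. 0 \<le> speed (decide A h) \<and> speed (decide A h) \<le> 1 \<and> 0 \<le> duration (decide A h))"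

record state =
  clock :: real
  position :: real
  heading :: real
  history :: "observation list"

definition initial_state :: "algorithm \<Rightarrow> state" where
  "initial_state A = \<lparr>clock = 0, position = 0, heading = start_heading A, history = []\<rparr>"

definition new_heading :: "command \<Rightarrow> bool \<Rightarrow> state \<Rightarrow> real" where
  "new_heading c fails s =
     (if attempt_turn c \<and> \<not> fails then - heading s else heading s)"

definition leg_time :: "command \<Rightarrow> bool \<Rightarrow> state \<Rightarrow> real" where
  "leg_time c fails s =
     (if position s * new_heading c fails s < 0 \<and> 0 < speed c \<and>
         \<bar>position s\<bar> \<le> speed c * duration c
      then \<bar>position s\<bar> / speed c else duration c)"

definition leg_position :: "command \<Rightarrow> bool \<Rightarrow> state \<Rightarrow> real \<Rightarrow> real" where
  "leg_position c fails s r = position s + new_heading c fails s * speed c * r"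

definition step :: "algorithm \<Rightarrow> bool \<Rightarrow> state \<Rightarrow> state" where
  "step A fails s =
     (let c = decide A (history s);
          e = leg_time c fails s;
          y = leg_position c fails s e
      in \<lparr>clock = clock s + e, position = y, heading = new_heading c fails s,
          history = history s @ [(e, y = 0)]\<rparr>)"

text \<open>
  The coin \<open>\<omega> n\<close> decides whether an attempt to turn at the start of leg \<open>n\<close> fails; it is
  ignored when there is no such attempt.
\<close>

primrec run :: "algorithm \<Rightarrow> (nat \<Rightarrow> bool) \<Rightarrow> nat \<Rightarrow> state" where
  "run A \<omega> 0 = initial_state A"
| "run A \<omega> (Suc n) = step A (\<omega> n) (run A \<omega> n)"

definition leg_hit_time :: "algorithm \<Rightarrow> real \<Rightarrow> bool \<Rightarrow> state \<Rightarrow> ennreal" where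
  "leg_hit_time A x fails s =
     (let c = decide A (history s)
      in INF r\<in>{r. 0 \<le> r \<and> r \<le> leg_time c fails s \<and> leg_position c fails s r = x}.
           ennreal (clock s + r))"

text \<open>The value is \<open>\<infinity>\<close> if the target is never reached.\<close>

definition hit_time :: "algorithm \<Rightarrow> real \<Rightarrow> (nat \<Rightarrow> bool) \<Rightarrow> ennreal" where
  "hit_time A x \<omega> = (INF n. leg_hit_time A x (\<omega> n) (run A \<omega> n))"

definition fault_space :: "real \<Rightarrow> (nat \<Rightarrow> bool) measure" where
  "fault_space p = (\<Pi>\<^sub>M n\<in>UNIV. measure_pmf (bernoulli_pmf p))"

definition expected_time :: "real \<Rightarrow> algorithm \<Rightarrow> real \<Rightarrow> ennreal" where
  "expected_time p A x = (\<integral>\<^sup>+ \<omega>. hit_time A x \<omega> \<partial>fault_space p)"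

definition competitive_ratio :: "real \<Rightarrow> algorithm \<Rightarrow> ennreal" where
  "competitive_ratio p A = Limsup at_infinity (\<lambda>x::real. expected_time p A x / ennreal \<bar>x\<bar>)"

lemma measurable_coin: "Measurable.pred (fault_space p) (\<lambda>\<omega>. \<omega> n)"
  unfolding fault_space_def by measurable

lemma measurable_run: "(\<lambda>\<omega>. run A \<omega> n) \<in> fault_space p \<rightarrow>\<^sub>M count_space UNIV"
proof (induction n)
  case (Suc n)
  have "(\<lambda>\<omega>. step A b (run A \<omega> n)) \<in> fault_space p \<rightarrow>\<^sub>M count_space UNIV" for b
    by (rule measurable_compose[OF Suc]) simp
  note [measurable] = this measurable_coin
  have "(\<lambda>\<omega>. if \<omega> n then step A True (run A \<omega> n) else step A False (run A \<omega> n))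
          \<in> fault_space p \<rightarrow>\<^sub>M count_space UNIV"
    by (intro measurable_If predE measurable_coin) measurable
  moreover have "(\<lambda>\<omega>. run A \<omega> (Suc n)) =
      (\<lambda>\<omega>. if \<omega> n then step A True (run A \<omega> n) else step A False (run A \<omega> n))"
    by (auto simp: fun_eq_iff)
  ultimately show ?case by simp
qed simp

lemma measurable_hit_time: "hit_time A x \<in> borel_measurable (fault_space p)"
proof -
  note [measurable] = measurable_coin
  have "(\<lambda>\<omega>. leg_hit_time A x (\<omega> n) (run A \<omega> n)) \<in> borel_measurable (fault_space p)" for n
  proof -
    have "(\<lambda>\<omega>. leg_hit_time A x b (run A \<omega> n)) \<in> borel_measurable (fault_space p)" for b
      by (rule measurable_compose[OF measurable_run]) simp
    note [measurable] = this
    have "(\<lambda>\<omega>. if \<omega> n then leg_hit_time A x True (run A \<omega> n)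
               else leg_hit_time A x False (run A \<omega> n)) \<in> borel_measurable (fault_space p)"
      by (intro measurable_If predE measurable_coin) measurable
    moreover have "(\<lambda>\<omega>. leg_hit_time A x (\<omega> n) (run A \<omega> n)) =
        (\<lambda>\<omega>. if \<omega> n then leg_hit_time A x True (run A \<omega> n)
             else leg_hit_time A x False (run A \<omega> n))"
      by (auto simp: fun_eq_iff)
    ultimately show ?thesis by simp
  qed
  then show ?thesis
    unfolding hit_time_def[abs_def] by (intro borel_measurable_INF) auto
qed

end

theory Submission
  imports Defs
begin

text \<open>
  Use a failed turn instead of undoing it. At stage \<open>m\<close> the agent stands at \<open>\<plusminus>b ^ m\<close> heading
  outwards and attempts to turn: if this succeeds it walks through the origin to \<open>\<mp>b ^ (m + 1)\<close>, if it
  fails it continues to \<open>\<plusminus>b ^ (m + 1)\<close>. Since \<open>b \<ge> 2\<close>, the leg is long enough for a successful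
  turn to be noticed at the origin. The elapsed time always equals the current distance from the
  origin plus \<open>2 * b ^ j\<close> for every successful turn \<open>j\<close> made so far. A target with
  \<open>b ^ n < \<bar>x\<bar> \<le> b ^ (n + 1)\<close> is found right after turn \<open>n\<close> if the agent is then on its side, and
  otherwise after the first successful turn \<open>k > n\<close>, which costs another \<open>2 * b ^ k\<close>. The side becomes
  uniformly distributed as \<open>n\<close> grows, so the ratio is worst for \<open>\<bar>x\<bar>\<close> just above \<open>b ^ n\<close> and tends to
  \<open>1 + 2 * (1 - p) * b / (b - 1) + (1 - p) * b / (1 - p * b)\<close>. With \<open>v = (1 - p) / (b - 1)\<close> this is
  \<open>4 - 2 * p + 2 * v + 1 / (v - p)\<close>, which is minimal at \<open>v = p + sqrt 2 / 2\<close>; the constraint \<open>b \<ge> 2\<close>,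
  that is \<open>v \<le> 1 - p\<close>, becomes active at the threshold for \<open>p\<close>.
\<close>

text \<open>
  Every stage takes exactly two legs, so that the coin of turn \<open>m\<close> is always \<open>2 * m + 1\<close>; after a
  failed turn the second leg has duration 0.
\<close>

definition zigzag :: "real \<Rightarrow> algorithm" where
  "zigzag b = \<lparr>start_heading = 1, decide = (\<lambda>h.
     if h = [] then \<lparr>attempt_turn = False, speed = 1, duration = 1\<rparr>
     else if odd (length h)
     then \<lparr>attempt_turn = True, speed = 1, duration = (b - 1) * b ^ (length h div 2)\<rparr>
     else \<lparr>attempt_turn = False, speed = 1,
           duration = (if snd (last h) then b ^ (length h div 2) else 0)\<rparr>)\<rparr>"

section \<open>The trajectory for a fixed sequence of coins\<close>

text \<open>The sign of the agent's position at turn \<open>m\<close>. A true coin is a failed turn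
  and keeps the sign; the product form lets the expectation factor over independent coins.\<close>

definition side :: "(nat \<Rightarrow> bool) \<Rightarrow> nat \<Rightarrow> real" where
  "side \<omega> m = (\<Prod>j<m. if \<omega> (2 * j + 1) then 1 else - 1)"

definition detour :: "real \<Rightarrow> (nat \<Rightarrow> bool) \<Rightarrow> nat \<Rightarrow> real" where
  "detour b \<omega> m = (\<Sum>j<m. if \<omega> (2 * j + 1) then 0 else 2 * b ^ j)"

text \<open>The state just before turn \<open>m\<close>, after the initial leg and two legs for each
  of the \<open>m\<close> earlier stages.\<close>

definition outbound :: "real \<Rightarrow> (nat \<Rightarrow> bool) \<Rightarrow> nat \<Rightarrow> state \<Rightarrow> bool" where
  "outbound b \<omega> m s \<longleftrightarrow>
     position s = side \<omega> m * b ^ m \<and> heading s = side \<omega> m \<and>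
     clock s = detour b \<omega> m + b ^ m \<and> length (history s) = 2 * m + 1"

text \<open>The state between the two legs of stage \<open>m\<close>. After a success the agent is
  at the origin and the whole excursion \<open>2 * b ^ m\<close> is already counted in
  \<open>detour\<close>; the recorded flag is what the algorithm uses to tell the two cases
  apart.\<close>

definition inbound :: "real \<Rightarrow> (nat \<Rightarrow> bool) \<Rightarrow> nat \<Rightarrow> state \<Rightarrow> bool" where
  "inbound b \<omega> m s \<longleftrightarrow>
     position s = (if \<omega> (2 * m + 1) then side \<omega> (Suc m) * b ^ Suc m else 0) \<and>
     heading s = side \<omega> (Suc m) \<and>
     clock s = detour b \<omega> (Suc m) + (if \<omega> (2 * m + 1) then b ^ Suc m else 0) \<and>
     length (history s) = 2 * m + 2 \<and> snd (last (history s)) = (\<not> \<omega> (2 * m + 1))"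

lemma admissible_zigzag: "b \<ge> 1 \<Longrightarrow> admissible (zigzag b)"
  by (simp add: admissible_def zigzag_def)

lemma side_Suc: "side \<omega> (Suc m) = (if \<omega> (2 * m + 1) then side \<omega> m else - side \<omega> m)"
  by (simp add: side_def)

lemma detour_Suc:
  "detour b \<omega> (Suc m) = detour b \<omega> m + (if \<omega> (2 * m + 1) then 0 else 2 * b ^ m)"
  by (simp add: detour_def)

lemma side_cases: "side \<omega> m = 1 \<or> side \<omega> m = -1"
  by (induction m) (auto simp: side_Suc, simp_all add: side_def)

lemma detour_nonneg: "b \<ge> 0 \<Longrightarrow> 0 \<le> detour b \<omega> m"
  unfolding detour_def by (intro sum_nonneg) auto

lemma detour_mono:
  assumes "b \<ge> 0" "m \<le> k"
  shows "detour b \<omega> m \<le> detour b \<omega> k"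
  unfolding detour_def using assms by (intro sum_mono2) auto

text \<open>After a successful turn the leg is cut off at the origin, because
  \<open>b \<ge> 2\<close> gives \<open>b ^ m \<le> (b - 1) * b ^ m\<close>. After a failed one it
  ends at distance \<open>b ^ Suc m\<close>, which is nonzero, so the origin flag reveals the
  outcome.\<close>

lemma outbound_leg:
  assumes b: "b \<ge> 2" and s: "outbound b \<omega> m s"
  shows "leg_time (decide (zigzag b) (history s)) (\<omega> (2 * m + 1)) s =
           (if \<omega> (2 * m + 1) then (b - 1) * b ^ m else b ^ m)"
    and "leg_position (decide (zigzag b) (history s)) (\<omega> (2 * m + 1)) s r =
           side \<omega> m * b ^ m + side \<omega> (Suc m) * r"
    and "inbound b \<omega> m (step (zigzag b) (\<omega> (2 * m + 1)) s)"
proof -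
  let ?c = "decide (zigzag b) (history s)" and ?f = "\<omega> (2 * m + 1)"
  have pos: "b ^ m > 0" "b ^ m \<le> (b - 1) * b ^ m"
    using b by (auto simp: mult_le_cancel_right1)
  have d: "?c = \<lparr>attempt_turn = True, speed = 1, duration = (b - 1) * b ^ m\<rparr>"
    using s by (auto simp: zigzag_def outbound_def)
  have h: "new_heading ?c ?f s = side \<omega> (Suc m)"
    using s unfolding d by (simp add: new_heading_def side_Suc outbound_def)
  have p: "position s = side \<omega> m * b ^ m"
    using s by (simp add: outbound_def)
  show e: "leg_time ?c ?f s = (if ?f then (b - 1) * b ^ m else b ^ m)"
    using pos side_cases[of \<omega> m]
    unfolding leg_time_def h unfolding d p by (auto simp: side_Suc abs_mult)
  show q: "leg_position ?c ?f s r = side \<omega> m * b ^ m + side \<omega> (Suc m) * r" for r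
    unfolding leg_position_def h unfolding d p by simp
  have y: "side \<omega> m * b ^ m + side \<omega> (Suc m) * (if ?f then (b - 1) * b ^ m else b ^ m)
       = (if ?f then side \<omega> (Suc m) * b ^ Suc m else 0)"
    by (auto simp: side_Suc algebra_simps)
  have "side \<omega> (Suc m) * b ^ Suc m \<noteq> 0"
    using b side_cases[of \<omega> "Suc m"] by auto
  then show "inbound b \<omega> m (step (zigzag b) ?f s)"
    using s unfolding inbound_def step_def Let_def e q y h outbound_def
    by (auto simp: detour_Suc algebra_simps)
qed

text \<open>No turn is attempted on this leg, so the coin \<open>f\<close> is arbitrary. Starting at
  the origin does not cut the leg short, since \<open>leg_time\<close> asks for motion towards the
  origin.\<close>

lemma inbound_leg:
  assumes b: "b \<ge> 2" and s: "inbound b \<omega> m s"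
  shows "leg_time (decide (zigzag b) (history s)) f s = (if \<omega> (2 * m + 1) then 0 else b ^ Suc m)"
    and "leg_position (decide (zigzag b) (history s)) f s r = position s + side \<omega> (Suc m) * r"
    and "outbound b \<omega> (Suc m) (step (zigzag b) f s)"
proof -
  let ?c = "decide (zigzag b) (history s)"
  have d: "?c = \<lparr>attempt_turn = False, speed = 1,
             duration = (if \<omega> (2 * m + 1) then 0 else b ^ Suc m)\<rparr>"
    using s by (auto simp: zigzag_def inbound_def)
  have h: "new_heading ?c f s = side \<omega> (Suc m)"
    using s unfolding d by (simp add: new_heading_def inbound_def)
  have p: "position s = (if \<omega> (2 * m + 1) then side \<omega> (Suc m) * b ^ Suc m else 0)"
    using s by (simp add: inbound_def)
  have pos: "b * b ^ m > 0" using b by simp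
  show e: "leg_time ?c f s = (if \<omega> (2 * m + 1) then 0 else b ^ Suc m)"
    using pos side_cases[of \<omega> "Suc m"]
    unfolding leg_time_def h unfolding d p by (auto simp: abs_mult)
  show q: "leg_position ?c f s r = position s + side \<omega> (Suc m) * r" for r
    unfolding leg_position_def h unfolding d by simp
  show "outbound b \<omega> (Suc m) (step (zigzag b) f s)"
    using s unfolding outbound_def step_def Let_def e q h by (auto simp: inbound_def)
qed

lemma run_outbound:
  assumes "b \<ge> 2"
  shows "outbound b \<omega> m (run (zigzag b) \<omega> (2 * m + 1))"
proof (induction m)
  case 0
  show ?case
    by (simp add: outbound_def step_def initial_state_def zigzag_def leg_time_def
        leg_position_def new_heading_def side_def detour_def Let_def)
next
  case (Suc m)
  show ?case
    using inbound_leg(3)[OF assms outbound_leg(3)[OF assms Suc]] by simp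
qed

lemma run_inbound:
  assumes "b \<ge> 2"
  shows "inbound b \<omega> m (run (zigzag b) \<omega> (2 * m + 2))"
  using outbound_leg(3)[OF assms run_outbound[OF assms]] by simp

section \<open>Hitting times for a fixed sequence of coins\<close>

lemma leg_hit_time_ge:
  assumes "\<And>r. 0 \<le> r \<Longrightarrow> r \<le> leg_time (decide A (history s)) f s \<Longrightarrow>
             leg_position (decide A (history s)) f s r = x \<Longrightarrow> t \<le> clock s + r"
  shows "ennreal t \<le> leg_hit_time A x f s"
  unfolding leg_hit_time_def Let_def using assms by (intro INF_greatest ennreal_leI) auto

lemma hit_time_le:
  assumes "0 \<le> r" "r \<le> leg_time (decide A (history (run A \<omega> k))) (\<omega> k) (run A \<omega> k)"
    "leg_position (decide A (history (run A \<omega> k))) (\<omega> k) (run A \<omega> k) r = x"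
  shows "hit_time A x \<omega> \<le> ennreal (clock (run A \<omega> k) + r)"
  unfolding hit_time_def leg_hit_time_def Let_def
  by (rule INF_lower2[of k], simp, rule INF_lower) (use assms in auto)

text \<open>\<open>M\<close> is the first turn index beyond \<open>n\<close> at which the agent is
  on the target's side. Before stage \<open>M - 1\<close> it never gets beyond \<open>b ^ n\<close>
  on that side, and at the end of that stage it stands there at distance
  \<open>b ^ M \<ge> \<bar>x\<bar>\<close>.\<close>

lemma hit_time_zigzag:
  assumes b: "b \<ge> 2" and x: "b ^ n < \<bar>x\<bar>" "\<bar>x\<bar> \<le> b ^ Suc n"
    and M: "n < M" "side \<omega> M = sgn x" "\<And>m. n < m \<Longrightarrow> m < M \<Longrightarrow> side \<omega> m = - sgn x"
  shows "hit_time (zigzag b) x \<omega> = ennreal (detour b \<omega> M + \<bar>x\<bar>)"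
proof (rule antisym)
  let ?A = "zigzag b" and ?\<sigma> = "sgn x"
  have x0: "x \<noteq> 0" using x(1) b by auto
  obtain m where m: "M = Suc m" using M(1) by (cases M) auto
  have s1: "?\<sigma> = 1 \<or> ?\<sigma> = -1" using x0 by (auto simp: sgn_if)
  have xs: "x = ?\<sigma> * \<bar>x\<bar>" by (simp add: sgn_mult_abs)
  have sx: "?\<sigma> * x = \<bar>x\<bar>" by (simp add: sgn_if)
  have bpos: "b ^ k > 0" for k using b by simp
  have bM: "\<bar>x\<bar> \<le> b ^ M"
  proof -
    have "b ^ Suc n \<le> b ^ M" using b M(1) by (intro power_increasing) auto
    with x(2) show ?thesis by linarith
  qed
  let ?o = "run ?A \<omega> (2 * m + 1)" and ?i = "run ?A \<omega> (2 * m + 2)"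
  note ro = run_outbound[OF b, of \<omega>] and ri = run_inbound[OF b, of \<omega>]
  show "hit_time ?A x \<omega> \<le> ennreal (detour b \<omega> M + \<bar>x\<bar>)"
  proof (cases "\<omega> (2 * m + 1)")
    case True
    have sm: "side \<omega> m = ?\<sigma>" using True M(2) by (simp add: m side_Suc)
    \<comment> \<open>If the last turn fails, the agent was on the target's side already at turn
      \<open>m\<close>, which the choice of \<open>M\<close> excludes unless \<open>m = n\<close>.
      The target is then met between the distances \<open>b ^ n\<close> and
      \<open>b ^ Suc n\<close>.\<close>
    have "m = n"
    proof (rule ccontr)
      assume "m \<noteq> n"
      then have "side \<omega> m = - ?\<sigma>" using M(1) m by (intro M(3)) auto
      with sm s1 show False by auto
    qed
    have "hit_time ?A x \<omega> \<le> ennreal (clock ?o + (\<bar>x\<bar> - b ^ m))"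
    proof (rule hit_time_le, unfold outbound_leg(1,2)[OF b ro])
      show "side \<omega> m * b ^ m + side \<omega> (Suc m) * (\<bar>x\<bar> - b ^ m) = x"
        using True sm xs by (simp add: side_Suc algebra_simps)
    qed (use True x \<open>m = n\<close> in \<open>auto simp: algebra_simps\<close>)
    also have "clock ?o + (\<bar>x\<bar> - b ^ m) = detour b \<omega> M + \<bar>x\<bar>"
      using ro[of m] True by (simp add: outbound_def m detour_Suc)
    finally show ?thesis .
  next
    case False
    have "hit_time ?A x \<omega> \<le> ennreal (clock ?i + \<bar>x\<bar>)"
    proof (rule hit_time_le, unfold inbound_leg(1,2)[OF b ri])
      show "position ?i + side \<omega> (Suc m) * \<bar>x\<bar> = x"
        using False M(2) xs ri[of m] by (simp add: m inbound_def)
    qed (use False bM in \<open>auto simp: m\<close>)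
    also have "clock ?i + \<bar>x\<bar> = detour b \<omega> M + \<bar>x\<bar>"
      using ri[of m] False by (simp add: inbound_def m)
    finally show ?thesis .
  qed
  \<comment> \<open>Measured in the direction of the target, no turning point before
    \<open>M\<close> exceeds \<open>b ^ n\<close>: those up to \<open>n\<close> are too close, the
    later ones lie on the other side.\<close>
  have endpoint: "?\<sigma> * side \<omega> k * b ^ k \<le> b ^ n" if "k < M" for k
  proof (cases "k \<le> n")
    case True
    have "?\<sigma> * side \<omega> k * b ^ k \<le> 1 * b ^ k"
      using b s1 side_cases[of \<omega> k] by (intro mult_right_mono) auto
    also have "\<dots> \<le> b ^ n" using b True by (auto intro: power_increasing)
    finally show ?thesis .
  next
    case False
    then have "side \<omega> k = - ?\<sigma>" using that by (intro M(3)) auto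
    then have "?\<sigma> * side \<omega> k * b ^ k = - (b ^ k)" using s1 by auto
    also have "\<dots> \<le> b ^ n" using b by (smt (verit) zero_le_power)
    finally show ?thesis .
  qed
  \<comment> \<open>From turn \<open>M\<close> on, the clock alone is at least the claimed
    value.\<close>
  have late: "detour b \<omega> M + \<bar>x\<bar> \<le> detour b \<omega> k + b ^ k" if "M \<le> k" for k
    using detour_mono[of b M k \<omega>] power_increasing[of M k b] bM b that by linarith
  have "ennreal (detour b \<omega> M + \<bar>x\<bar>) \<le> leg_hit_time ?A x (\<omega> k) (run ?A \<omega> k)" for k
  proof -
    have "k = 0 \<or> (\<exists>j. k = 2 * j + 1) \<or> (\<exists>j. k = 2 * j + 2)"
      by presburger
    then consider "k = 0" | j where "k = 2 * j + 1" | j where "k = 2 * j + 2"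
      by blast
    then show ?thesis
    proof cases
      case 1
      have "1 \<le> b ^ n" using b by simp
      then show ?thesis unfolding 1
        using x by (intro leg_hit_time_ge)
          (auto simp: zigzag_def initial_state_def leg_time_def leg_position_def new_heading_def)
    next
      case (2 j)
      show ?thesis unfolding 2
      proof (rule leg_hit_time_ge, unfold outbound_leg(1,2)[OF b ro])
        fix r
        assume r: "0 \<le> r" "r \<le> (if \<omega> (2 * j + 1) then (b - 1) * b ^ j else b ^ j)"
          and e: "side \<omega> j * b ^ j + side \<omega> (Suc j) * r = x"
        have c: "clock (run ?A \<omega> (2 * j + 1)) = detour b \<omega> j + b ^ j"
          using ro[of j] by (simp add: outbound_def)
        consider "M \<le> j" | "Suc j < M" | "Suc j = M" by linarith
        then show "detour b \<omega> M + \<bar>x\<bar> \<le> clock (run ?A \<omega> (2 * j + 1)) + r"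
        proof cases
          case 1
          then show ?thesis using late[of j] c r(1) by linarith
        next
          case 2
          \<comment> \<open>A leg is a segment, so it suffices that both its ends, one being the
            origin after a success, have coordinate at most \<open>b ^ n\<close> towards the
            target.\<close>
          define a where "a = ?\<sigma> * side \<omega> j"
          have a: "a = 1 \<or> a = -1" using s1 side_cases[of \<omega> j] by (auto simp: a_def)
          have "?\<sigma> * x = a * b ^ j + (if \<omega> (2 * j + 1) then a else - a) * r"
            unfolding e[symmetric] a_def by (simp add: side_Suc algebra_simps)
          moreover have "a * b ^ j \<le> b ^ n"
            and "(if \<omega> (2 * j + 1) then a else - a) * b ^ Suc j \<le> b ^ n"
            using endpoint[of j] endpoint[of "Suc j"] 2 by (auto simp: a_def side_Suc)
          ultimately have "?\<sigma> * x \<le> b ^ n"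
            using a r bpos[of j] bpos[of n] by (auto simp: algebra_simps split: if_splits)
          then show ?thesis using x(1) sx by linarith
        next
          case 3
          \<comment> \<open>On the decisive stage the position determines \<open>r\<close>, and the
            clock plus \<open>r\<close> equals the claimed value for either outcome of the
            coin.\<close>
          have "side \<omega> (Suc j) = ?\<sigma>" using 3 M(2) by simp
          moreover from this have "side \<omega> j = (if \<omega> (2 * j + 1) then ?\<sigma> else - ?\<sigma>)"
            by (auto simp: side_Suc split: if_splits)
          moreover have "\<bar>x\<bar> = ?\<sigma> * (side \<omega> j * b ^ j + side \<omega> (Suc j) * r)"
            using sx e by simp
          ultimately have "\<bar>x\<bar> = r + (if \<omega> (2 * j + 1) then b ^ j else - (b ^ j))"
            using s1 by (elim disjE) simp_all
          then show ?thesis using c 3 by (auto simp: detour_Suc split: if_splits)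
        qed
      qed
    next
      case (3 j)
      show ?thesis unfolding 3
      proof (rule leg_hit_time_ge, unfold inbound_leg(1,2)[OF b ri])
        fix r
        assume r: "0 \<le> r" "r \<le> (if \<omega> (2 * j + 1) then 0 else b ^ Suc j)"
          and e: "position (run ?A \<omega> (2 * j + 2)) + side \<omega> (Suc j) * r = x"
        have c: "clock (run ?A \<omega> (2 * j + 2)) =
            detour b \<omega> (Suc j) + (if \<omega> (2 * j + 1) then b ^ Suc j else 0)"
          and p: "position (run ?A \<omega> (2 * j + 2)) =
            (if \<omega> (2 * j + 1) then side \<omega> (Suc j) * b ^ Suc j else 0)"
          using ri[of j] by (simp_all add: inbound_def)
        have bj: "b ^ j \<le> b ^ Suc j" using b by (intro power_increasing) auto
        consider "M \<le> j" | "Suc j < M" | "Suc j = M" by linarith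
        then show "detour b \<omega> M + \<bar>x\<bar> \<le> clock (run ?A \<omega> (2 * j + 2)) + r"
        proof cases
          case 1
          have "detour b \<omega> j + b ^ j \<le> clock (run ?A \<omega> (2 * j + 2))"
            unfolding c detour_Suc using bj bpos[of j] by (simp del: power_Suc)
          then show ?thesis using late[OF 1] r(1) by linarith
        next
          case 2
          define a where "a = ?\<sigma> * side \<omega> (Suc j)"
          have a: "a = 1 \<or> a = -1" using s1 side_cases[of \<omega> "Suc j"] by (auto simp: a_def)
          have "?\<sigma> * x = a * ((if \<omega> (2 * j + 1) then b ^ Suc j else 0) + r)"
            unfolding e[symmetric] a_def p by (simp add: algebra_simps)
          moreover have "a * b ^ Suc j \<le> b ^ n"
            using endpoint[of "Suc j"] 2 by (simp add: a_def)
          ultimately have "?\<sigma> * x \<le> b ^ n"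
            using a r bpos[of "Suc j"] bpos[of n] by (auto split: if_splits)
          then show ?thesis using x(1) sx by linarith
        next
          case 3
          have "side \<omega> (Suc j) = ?\<sigma>" using 3 M(2) by simp
          moreover have "\<bar>x\<bar> = ?\<sigma> * (position (run ?A \<omega> (2 * j + 2)) + side \<omega> (Suc j) * r)"
            using sx e by simp
          ultimately have "\<bar>x\<bar> = r + (if \<omega> (2 * j + 1) then b ^ Suc j else 0)"
            using s1 unfolding p by (elim disjE) simp_all
          then show ?thesis unfolding c 3 by simp
        qed
      qed
    qed
  qed
  then show "ennreal (detour b \<omega> M + \<bar>x\<bar>) \<le> hit_time ?A x \<omega>"
    unfolding hit_time_def by (rule INF_greatest)
qed

section \<open>Independence of the coins\<close>

lemma prob_space_fault_space: "prob_space (fault_space p)"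
  unfolding fault_space_def by (intro prob_space_PiM) unfold_locales

text \<open>Injectivity of \<open>g\<close> makes the selected coins distinct, hence independent:
  the integral reduces to a finite marginal of the product measure and factors there.\<close>

lemma integral_prod_coins:
  fixes f :: "'i \<Rightarrow> bool \<Rightarrow> real" and g :: "'i \<Rightarrow> nat"
  assumes p: "0 \<le> p" "p \<le> 1" and J: "finite J" "inj_on g J"
  shows "(\<integral>\<omega>. (\<Prod>j\<in>J. f j (\<omega> (g j))) \<partial>fault_space p) = (\<Prod>j\<in>J. p * f j True + (1 - p) * f j False)"
proof -
  let ?B = "\<lambda>_::nat. measure_pmf (bernoulli_pmf p)" and ?K = "g ` J"
  let ?f = "\<lambda>i. f (the_inv_into J g i)"
  interpret product_prob_space ?B UNIV by unfold_locales
  have int: "integrable (?B i) h" for i and h :: "bool \<Rightarrow> real"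
    by (rule integrable_measure_pmf_finite) simp
  have "(\<integral>\<omega>. (\<Prod>j\<in>J. f j (\<omega> (g j))) \<partial>fault_space p) =
        (\<integral>\<omega>. (\<Prod>i\<in>?K. ?f i (restrict \<omega> ?K i)) \<partial>fault_space p)"
    using J(2) by (simp add: prod.reindex the_inv_into_f_f)
  also have "\<dots> = (\<integral>\<omega>. (\<Prod>i\<in>?K. ?f i (\<omega> i)) \<partial>distr (fault_space p) (PiM ?K ?B) (\<lambda>\<omega>. restrict \<omega> ?K))"
    unfolding fault_space_def
  proof (rule integral_distr[symmetric])
    show "(\<lambda>\<omega>. restrict \<omega> ?K) \<in> PiM UNIV ?B \<rightarrow>\<^sub>M PiM ?K ?B"
      by (rule measurable_restrict_subset) simp
    show "(\<lambda>\<omega>. \<Prod>i\<in>?K. ?f i (\<omega> i)) \<in> borel_measurable (PiM ?K ?B)"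
      by (intro borel_measurable_prod measurable_compose[OF measurable_component_singleton]) auto
  qed
  also have "distr (fault_space p) (PiM ?K ?B) (\<lambda>\<omega>. restrict \<omega> ?K) = PiM ?K ?B"
    using J(1) unfolding fault_space_def by (intro distr_PiM_restrict_finite) auto
  also have "(\<integral>\<omega>. (\<Prod>i\<in>?K. ?f i (\<omega> i)) \<partial>PiM ?K ?B) = (\<Prod>i\<in>?K. \<integral>t. ?f i t \<partial>?B i)"
    using J(1) by (intro product_integral_prod int) auto
  also have "\<dots> = (\<Prod>j\<in>J. \<integral>t. f j t \<partial>measure_pmf (bernoulli_pmf p))"
    using J(2) by (simp add: prod.reindex the_inv_into_f_f)
  finally show ?thesis using p by (simp add: mult.commute)
qed

lemma integral_coin:
  assumes "0 \<le> p" "p \<le> 1"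
  shows "(\<integral>\<omega>. f (\<omega> i) \<partial>fault_space p) = p * f True + (1 - p) * (f False :: real)"
  using integral_prod_coins[of p "{i}" "\<lambda>i. i" "\<lambda>_. f"] assms by simp

text \<open>If all selected coins fail, so do the first \<open>m\<close> of them, which has
  probability \<open>p ^ m\<close>; this tends to 0.\<close>

lemma AE_coin_succeeds:
  fixes g :: "nat \<Rightarrow> nat"
  assumes p: "0 \<le> p" "p < 1" and g: "inj g"
  shows "AE \<omega> in fault_space p. \<exists>k. \<not> \<omega> (g k)"
proof -
  interpret prob_space "fault_space p" by (rule prob_space_fault_space)
  note [measurable] = measurable_coin[where p = p]
  let ?N = "{\<omega> \<in> space (fault_space p). \<forall>k. \<omega> (g k)}"
  have "Measurable.pred (fault_space p) (\<lambda>\<omega>. \<forall>k. \<omega> (g k))"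
    by (intro pred_intros_countable(1) measurable_coin)
  then have N: "?N \<in> events" by (simp add: pred_def)
  have "prob ?N \<le> p ^ m" for m
  proof -
    let ?X = "\<lambda>\<omega>. \<Prod>k<m. of_bool (\<omega> (g k)) :: real"
    have "prob ?N = (\<integral>\<omega>. indicator ?N \<omega> \<partial>fault_space p)"
      using N by simp
    also have "\<dots> \<le> (\<integral>\<omega>. ?X \<omega> \<partial>fault_space p)"
    proof (rule integral_mono)
      show "integrable (fault_space p) ?X"
        by (rule integrable_const_bound[of _ 1]) (auto simp: abs_prod intro!: prod_le_1)
      show "integrable (fault_space p) (indicator ?N :: _ \<Rightarrow> real)"
        using N by (simp add: emeasure_eq_measure)
      show "indicator ?N \<omega> \<le> ?X \<omega>" for \<omega>
        by (cases "\<omega> \<in> ?N") (auto intro!: prod_nonneg)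
    qed
    also have "\<dots> = p ^ m"
      using p g by (subst integral_prod_coins) (auto intro: inj_on_subset)
    finally show ?thesis .
  qed
  then have "prob ?N \<le> 0"
    using LIMSEQ_le_const[OF LIMSEQ_realpow_zero[OF p]] by blast
  then have "emeasure (fault_space p) ?N = 0" by (simp add: emeasure_eq_measure measure_le_0_iff)
  then show ?thesis using N by (intro AE_I[of _ _ ?N]) auto
qed

section \<open>The law of the first successful turn\<close>

text \<open>Indicator of the event that, from turn \<open>m\<close> on, exactly \<open>k\<close>
  failures precede the first success, written as a product over coins.\<close>

definition first_turn :: "nat \<Rightarrow> nat \<Rightarrow> (nat \<Rightarrow> bool) \<Rightarrow> real" where
  "first_turn m k \<omega> =
     (\<Prod>j<k. of_bool (\<omega> (2 * (m + j) + 1))) * of_bool (\<not> \<omega> (2 * (m + k) + 1))"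

lemma first_turn_bounds: "0 \<le> first_turn m k \<omega>" "first_turn m k \<omega> \<le> 1"
  unfolding first_turn_def by (auto intro!: prod_nonneg prod_le_1)

lemma measurable_side: "(\<lambda>\<omega>. side \<omega> m) \<in> borel_measurable (fault_space p)"
  unfolding side_def by (intro borel_measurable_prod measurable_If predE measurable_coin) simp_all

lemma measurable_detour: "(\<lambda>\<omega>. detour b \<omega> m) \<in> borel_measurable (fault_space p)"
  unfolding detour_def by (intro borel_measurable_sum measurable_If predE measurable_coin) simp_all

lemma measurable_first_turn: "first_turn m k \<in> borel_measurable (fault_space p)"
proof -
  note [measurable] = measurable_coin[where p = p]
  show ?thesis unfolding first_turn_def[abs_def] by measurable
qed

lemma prod_lessThan_add:
  "(\<Prod>j<m + k. f j) = (\<Prod>j<m. f j) * (\<Prod>j<k. f (m + j))"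
  for f :: "nat \<Rightarrow> 'a :: comm_monoid_mult"
  by (induction k) (simp_all add: mult.assoc)

text \<open>The parameter \<open>c\<close> covers two cases at once: \<open>c = 1\<close> makes the
  prefix trivial and \<open>c = -1\<close> turns it into \<open>side \<omega> m\<close>.\<close>

lemma integral_prefix_first_turn:
  assumes p: "0 \<le> p" "p \<le> 1"
  shows "(\<integral>\<omega>. (\<Prod>j<m. if \<omega> (2 * j + 1) then 1 else c) * first_turn m k \<omega> \<partial>fault_space p)
       = (p + (1 - p) * c) ^ m * (p ^ k * (1 - p))"
proof -
  \<comment> \<open>One factor per turn: the first \<open>m\<close> carry the prefix, the next
    \<open>k\<close> must fail, and turn \<open>m + k\<close> must succeed.\<close>
  define F where "F j t = (if j < m then if t then 1 else c
    else if j < m + k then of_bool t else of_bool (\<not> t))" for j t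
  have "(\<Prod>j<m. if \<omega> (2 * j + 1) then 1 else c) * first_turn m k \<omega>
      = (\<Prod>j<Suc (m + k). F j (\<omega> (2 * j + 1)))" for \<omega>
    by (simp add: prod_lessThan_add F_def first_turn_def mult.assoc)
  moreover have "(\<integral>\<omega>. (\<Prod>j<Suc (m + k). F j (\<omega> (2 * j + 1))) \<partial>fault_space p)
      = (\<Prod>j<Suc (m + k). p * F j True + (1 - p) * F j False)"
    by (intro integral_prod_coins p) (auto intro: inj_onI)
  moreover have "\<dots> = (p + (1 - p) * c) ^ m * (p ^ k * (1 - p))"
    by (simp add: prod_lessThan_add F_def mult.assoc)
  ultimately show ?thesis by simp
qed

lemma integral_first_turn:
  assumes "0 \<le> p" "p \<le> 1"
  shows "(\<integral>\<omega>. first_turn m k \<omega> \<partial>fault_space p) = p ^ k * (1 - p)"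
  using integral_prefix_first_turn[OF assms, where m = m and c = 1 and k = k] by (simp cong: if_cong)

lemma integral_side_first_turn:
  assumes "0 \<le> p" "p \<le> 1"
  shows "(\<integral>\<omega>. side \<omega> m * first_turn m k \<omega> \<partial>fault_space p) = (2 * p - 1) ^ m * (p ^ k * (1 - p))"
  using integral_prefix_first_turn[OF assms, where m = m and c = "-1" and k = k]
  by (simp add: side_def cong: if_cong)

lemma integral_detour:
  assumes p: "0 \<le> p" "p \<le> 1" and "b \<noteq> 1"
  shows "(\<integral>\<omega>. detour b \<omega> m \<partial>fault_space p) = 2 * (1 - p) * (b ^ m - 1) / (b - 1)"
proof -
  interpret prob_space "fault_space p" by (rule prob_space_fault_space)
  have "integrable (fault_space p) (\<lambda>\<omega>. if \<omega> i then 0 else c)" for i and c :: real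
  proof (rule integrable_const_bound[of _ "\<bar>c\<bar>"])
    show "(\<lambda>\<omega>. if \<omega> i then 0 else c) \<in> borel_measurable (fault_space p)"
      by (intro measurable_If predE measurable_coin) simp_all
  qed auto
  then have "(\<integral>\<omega>. detour b \<omega> m \<partial>fault_space p) = (\<Sum>j<m. (1 - p) * (2 * b ^ j))"
    unfolding detour_def using p
    by (simp add: integral_coin[where f = "\<lambda>t. if t then 0 else _"])
  also have "\<dots> = 2 * (1 - p) * (\<Sum>j<m. b ^ j)"
    unfolding sum_distrib_left by (intro sum.cong) (simp_all add: algebra_simps)
  finally show ?thesis using \<open>b \<noteq> 1\<close> by (simp add: geometric_sum)
qed

section \<open>The expected hitting time\<close>

text \<open>The factor \<open>1 - sgn x * side \<omega> (Suc n)\<close> is 0 on the target's side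
  and 2 on the other, so it selects the case and supplies the factor 2 of the extra detour;
  \<open>first_turn\<close> picks the single relevant \<open>k\<close>. The series can be integrated
  term by term.\<close>

lemma hit_time_zigzag_first_turn:
  assumes b: "b \<ge> 2" and x: "b ^ n < \<bar>x\<bar>" "\<bar>x\<bar> \<le> b ^ Suc n"
    and \<omega>: "\<exists>k. \<not> \<omega> (2 * (Suc n + k) + 1)"
  shows "hit_time (zigzag b) x \<omega> = ennreal (detour b \<omega> (Suc n) + \<bar>x\<bar>) +
    (\<Sum>k. ennreal (b ^ (Suc n + k) * ((1 - sgn x * side \<omega> (Suc n)) * first_turn (Suc n) k \<omega>)))"
proof -
  let ?m = "Suc n" and ?\<sigma> = "sgn x"
  have s1: "?\<sigma> = 1 \<or> ?\<sigma> = -1" using x(1) b by (auto simp: sgn_if)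
  define K where "K = (LEAST k. \<not> \<omega> (2 * (?m + k) + 1))"
  have K: "\<not> \<omega> (2 * (?m + K) + 1)"
    unfolding K_def using \<omega> by (rule LeastI_ex)
  have before: "\<omega> (2 * (?m + k) + 1)" if "k < K" for k
    using not_less_Least[OF that[unfolded K_def]] by blast
  have turn: "first_turn ?m k \<omega> = of_bool (k = K)" for k
  proof -
    consider "k < K" | "k = K" | "K < k" by linarith
    then show ?thesis
    proof cases
      case 3
      then have "(\<Prod>j<k. of_bool (\<omega> (2 * (?m + j) + 1)) :: real) = 0"
        using K by (intro prod_zero) auto
      then show ?thesis using 3 by (simp add: first_turn_def)
    qed (use K before in \<open>auto simp: first_turn_def\<close>)
  qed
  have stay: "side \<omega> (?m + k) = side \<omega> ?m \<and> detour b \<omega> (?m + k) = detour b \<omega> ?m" if "k \<le> K" for k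
    using that
  proof (induction k)
    case (Suc k)
    then show ?case
      using before[of k] side_Suc[of \<omega> "?m + k"] detour_Suc[of b \<omega> "?m + k"] by simp
  qed simp
  show ?thesis
  proof (cases "side \<omega> ?m = ?\<sigma>")
    case True
    have "hit_time (zigzag b) x \<omega> = ennreal (detour b \<omega> ?m + \<bar>x\<bar>)"
      using True by (intro hit_time_zigzag[OF b x]) auto
    moreover have "1 - ?\<sigma> * side \<omega> ?m = 0" using True s1 by auto
    ultimately show ?thesis by simp
  next
    case False
    then have wrong: "side \<omega> ?m = - ?\<sigma>" using s1 side_cases[of \<omega> ?m] by auto
    \<comment> \<open>Index \<open>M\<close> takes the coins of the turns below \<open>M\<close>
      into account, so the successful turn \<open>?m + K\<close> first shows at the next
      index.\<close>
    let ?M = "Suc (?m + K)"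
    have "hit_time (zigzag b) x \<omega> = ennreal (detour b \<omega> ?M + \<bar>x\<bar>)"
    proof (rule hit_time_zigzag[OF b x])
      show "side \<omega> ?M = ?\<sigma>"
        using K stay[of K] wrong side_Suc[of \<omega> "?m + K"] by simp
      fix m assume "n < m" "m < ?M"
      then show "side \<omega> m = - ?\<sigma>" using stay[of "m - ?m"] wrong by simp
    qed simp
    also have "detour b \<omega> ?M + \<bar>x\<bar> = (detour b \<omega> ?m + \<bar>x\<bar>) + 2 * b ^ (?m + K)"
      using K stay[of K] detour_Suc[of b \<omega> "?m + K"] by simp
    also have "ennreal \<dots> = ennreal (detour b \<omega> ?m + \<bar>x\<bar>) + ennreal (2 * b ^ (?m + K))"
      using b by (intro ennreal_plus add_nonneg_nonneg) (auto simp: detour_nonneg)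
    also have "1 - ?\<sigma> * side \<omega> ?m = 2" using wrong s1 by auto
    then have "ennreal (2 * b ^ (?m + K)) =
      (\<Sum>k. ennreal (b ^ (?m + k) * ((1 - ?\<sigma> * side \<omega> ?m) * first_turn ?m k \<omega>)))"
      by (subst suminf_finite[of "{K}"]) (auto simp: turn mult.commute)
    finally show ?thesis .
  qed
qed

text \<open>Waiting through \<open>k\<close> failures costs a multiple of \<open>b ^ k\<close> with
  a probability proportional to \<open>p ^ k\<close>; the series converges because
  \<open>p * b < 1\<close>. The term \<open>(2 * p - 1) ^ Suc n\<close> is the mean of
  \<open>side\<close>, the remaining bias towards one side.\<close>

lemma expected_time_zigzag:
  assumes p: "0 < p" "p < 1" and b: "b \<ge> 2" "p * b < 1"
    and x: "b ^ n < \<bar>x\<bar>" "\<bar>x\<bar> \<le> b ^ Suc n"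
  shows "expected_time p (zigzag b) x = ennreal (\<bar>x\<bar> + 2 * (1 - p) * (b ^ Suc n - 1) / (b - 1) +
           (1 - sgn x * (2 * p - 1) ^ Suc n) * (1 - p) * b ^ Suc n / (1 - p * b))"
proof -
  interpret prob_space "fault_space p" by (rule prob_space_fault_space)
  let ?m = "Suc n" and ?F = "fault_space p"
  let ?D = "\<lambda>\<omega>. detour b \<omega> ?m + \<bar>x\<bar>"
  let ?R = "\<lambda>k \<omega>. b ^ (?m + k) * ((1 - sgn x * side \<omega> ?m) * first_turn ?m k \<omega>)"
  \<comment> \<open>\<open>w * p ^ k\<close> is the expectation of
    \<open>(1 - sgn x * side \<omega> ?m) * first_turn ?m k \<omega>\<close>.\<close>
  define w where "w = (1 - sgn x * (2 * p - 1) ^ ?m) * (1 - p)"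
  note [measurable] = measurable_side measurable_detour measurable_first_turn
  have s: "\<bar>sgn x * side \<omega> ?m\<bar> \<le> 1" for \<omega>
    using side_cases[of \<omega> ?m] by (auto simp: sgn_if)
  have w0: "w \<ge> 0"
  proof -
    have "\<bar>(2 * p - 1) ^ ?m\<bar> \<le> 1" using p unfolding power_abs by (intro power_le_one) auto
    then show ?thesis unfolding w_def using p by (intro mult_nonneg_nonneg) (auto simp: sgn_if)
  qed
  have D_int: "(\<integral>\<^sup>+ \<omega>. ennreal (?D \<omega>) \<partial>?F) =
      ennreal (2 * (1 - p) * (b ^ ?m - 1) / (b - 1) + \<bar>x\<bar>)"
  proof -
    have D: "0 \<le> detour b \<omega> ?m" for \<omega>
      using b by (intro detour_nonneg) simp
    have "detour b \<omega> ?m \<le> (\<Sum>j<?m. 2 * b ^ j)" for \<omega>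
      unfolding detour_def using b by (intro sum_mono) simp
    then have "integrable ?F (\<lambda>\<omega>. detour b \<omega> ?m)"
      using D by (intro integrable_const_bound[of _ "\<Sum>j<?m. 2 * b ^ j"]) auto
    then show ?thesis
      using D p b by (subst nn_integral_eq_integral) (auto simp: integral_detour prob_space)
  qed
  have R_int: "(\<integral>\<^sup>+ \<omega>. ennreal (?R k \<omega>) \<partial>?F) = ennreal (w * b ^ ?m * (p * b) ^ k)" for k
  proof -
    have i1: "integrable ?F (first_turn ?m k)"
      using first_turn_bounds by (intro integrable_const_bound[of _ 1]) auto
    have i2: "integrable ?F (\<lambda>\<omega>. side \<omega> ?m * first_turn ?m k \<omega>)"
    proof (rule integrable_const_bound[of _ 1])
      show "AE \<omega> in ?F. norm (side \<omega> ?m * first_turn ?m k \<omega>) \<le> 1"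
      proof (rule AE_I2)
        fix \<omega> show "norm (side \<omega> ?m * first_turn ?m k \<omega>) \<le> 1"
          using side_cases[of \<omega> ?m] first_turn_bounds[of ?m k \<omega>] by auto
      qed
    qed measurable
    have R: "?R k \<omega> = b ^ (?m + k) * (first_turn ?m k \<omega> - sgn x * (side \<omega> ?m * first_turn ?m k \<omega>))"
      for \<omega> by (simp add: algebra_simps)
    have "0 \<le> ?R k \<omega>" for \<omega>
      using s[of \<omega>] b first_turn_bounds(1)[of ?m k \<omega>] by (intro mult_nonneg_nonneg) auto
    then have "(\<integral>\<^sup>+ \<omega>. ennreal (?R k \<omega>) \<partial>?F) = ennreal (\<integral>\<omega>. ?R k \<omega> \<partial>?F)"
      using i1 i2 unfolding R by (intro nn_integral_eq_integral) auto
    also have "(\<integral>\<omega>. ?R k \<omega> \<partial>?F) = w * b ^ ?m * (p * b) ^ k"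
      unfolding R using i1 i2 p
      by (simp add: integral_first_turn integral_side_first_turn w_def power_add
          power_mult_distrib algebra_simps)
    finally show ?thesis .
  qed
  have "inj (\<lambda>k. 2 * (?m + k) + 1)" by (auto intro: injI)
  then have "AE \<omega> in ?F. \<exists>k. \<not> \<omega> (2 * (?m + k) + 1)"
    using p by (intro AE_coin_succeeds) auto
  then have "expected_time p (zigzag b) x =
      (\<integral>\<^sup>+ \<omega>. ennreal (?D \<omega>) + (\<Sum>k. ennreal (?R k \<omega>)) \<partial>?F)"
    unfolding expected_time_def
    by (intro nn_integral_cong_AE, elim eventually_mono)
      (rule hit_time_zigzag_first_turn[OF b(1) x])
  also have "\<dots> = (\<integral>\<^sup>+ \<omega>. ennreal (?D \<omega>) \<partial>?F) + (\<Sum>k. \<integral>\<^sup>+ \<omega>. ennreal (?R k \<omega>) \<partial>?F)"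
    by (simp add: nn_integral_add nn_integral_suminf)
  also have "\<dots> = ennreal (2 * (1 - p) * (b ^ ?m - 1) / (b - 1) + \<bar>x\<bar>) +
      (\<Sum>k. ennreal (w * b ^ ?m * (p * b) ^ k))"
    unfolding D_int R_int ..
  also have "(\<Sum>k. ennreal (w * b ^ ?m * (p * b) ^ k)) = ennreal (w * b ^ ?m / (1 - p * b))"
  proof (rule suminf_ennreal_eq)
    show "(\<lambda>k. w * b ^ ?m * (p * b) ^ k) sums (w * b ^ ?m / (1 - p * b))"
      using sums_mult[OF geometric_sums[of "p * b"], of "w * b ^ ?m"] p b by simp
  qed (use w0 p b in auto)
  also have "ennreal (2 * (1 - p) * (b ^ ?m - 1) / (b - 1) + \<bar>x\<bar>) + ennreal (w * b ^ ?m / (1 - p * b))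
      = ennreal (2 * (1 - p) * (b ^ ?m - 1) / (b - 1) + \<bar>x\<bar> + w * b ^ ?m / (1 - p * b))"
    using w0 p b one_le_power[of b ?m] by (intro ennreal_plus[symmetric]) (auto simp del: power_Suc)
  finally show ?thesis by (simp add: w_def algebra_simps)
qed

section \<open>The limit superior over distant targets\<close>

lemma ex_power_interval:
  fixes b y :: real
  assumes "b > 1" "y > 1"
  shows "\<exists>n. b ^ n < y \<and> y \<le> b ^ Suc n"
proof -
  define k where "k = (LEAST k. y \<le> b ^ k)"
  have "\<exists>k. y \<le> b ^ k"
    using real_arch_pow[OF assms(1), of y] by (auto intro: less_imp_le)
  then have k: "y \<le> b ^ k" unfolding k_def by (rule LeastI_ex)
  with assms(2) obtain n where n: "k = Suc n" by (cases k) auto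
  have "\<not> y \<le> b ^ n" using n by (intro not_less_Least) (simp add: k_def)
  with k n show ?thesis by (auto simp: not_le)
qed

text \<open>The upper bound uses \<open>b ^ Suc n \<le> b * \<bar>x\<bar>\<close>, which is nearly
  sharp for targets just above \<open>b ^ n\<close>; these give the lower bound. The bias
  \<open>e ^ Suc n\<close> vanishes since \<open>\<bar>e\<bar> < 1\<close>.\<close>

lemma competitive_ratio_zigzag:
  assumes p: "0 < p" "p < 1" and b: "b \<ge> 2" "p * b < 1"
  shows "competitive_ratio p (zigzag b) =
           ennreal (1 + 2 * (1 - p) * b / (b - 1) + (1 - p) * b / (1 - p * b))"
    (is "_ = ennreal ?L")
proof (rule antisym)
  let ?f = "\<lambda>x. expected_time p (zigzag b) x / ennreal \<bar>x\<bar>"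
  define c d e where "c = 2 * (1 - p) / (b - 1)" and "d = (1 - p) / (1 - p * b)"
    and "e = 2 * p - 1"
  have cd: "c \<ge> 0" "d \<ge> 0" and e: "\<bar>e\<bar> < 1"
    using p b by (auto simp: c_def d_def e_def)
  define U where "U N = 1 + c * b + (1 + \<bar>e\<bar> ^ N) * (d * b)" for N
  have L: "?L = 1 + c * b + (1 + 0) * (d * b)" by (simp add: c_def d_def)
  have f: "?f x = ennreal (1 + (c * (b ^ Suc n - 1) + (1 - sgn x * e ^ Suc n) * (d * b ^ Suc n)) / \<bar>x\<bar>)"
    (is "_ = ennreal ?r")
    and r: "0 \<le> (1 - sgn x * e ^ Suc n)" "(1 - sgn x * e ^ Suc n) \<le> 1 + \<bar>e\<bar> ^ Suc n"
    if x: "b ^ n < \<bar>x\<bar>" "\<bar>x\<bar> \<le> b ^ Suc n" for x n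
  proof -
    have bn: "1 \<le> b ^ n" "1 \<le> b ^ Suc n" using b by (intro one_le_power; simp)+
    have x0: "\<bar>x\<bar> > 0" using x(1) bn(1) by linarith
    have "\<bar>sgn x * e ^ Suc n\<bar> = \<bar>e\<bar> ^ Suc n"
      using x0 by (simp add: abs_mult power_abs abs_sgn_eq)
    moreover have "\<bar>e\<bar> ^ Suc n \<le> 1" using e by (intro power_le_one) auto
    ultimately show r: "0 \<le> (1 - sgn x * e ^ Suc n)" "(1 - sgn x * e ^ Suc n) \<le> 1 + \<bar>e\<bar> ^ Suc n"
      by linarith+
    have "expected_time p (zigzag b) x =
        ennreal (\<bar>x\<bar> + (c * (b ^ Suc n - 1) + (1 - sgn x * e ^ Suc n) * (d * b ^ Suc n)))"
      unfolding expected_time_zigzag[OF p b x] c_def d_def e_def by (simp add: mult_ac add.assoc)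
    moreover have "0 \<le> c * (b ^ Suc n - 1) + (1 - sgn x * e ^ Suc n) * (d * b ^ Suc n)"
      using cd r(1) bn b by (intro add_nonneg_nonneg mult_nonneg_nonneg) auto
    moreover have "ennreal (\<bar>x\<bar> + t) / ennreal \<bar>x\<bar> = ennreal (1 + t / \<bar>x\<bar>)" if "0 \<le> t" for t
      using x0 that by (simp add: divide_ennreal add_divide_distrib del: ennreal_plus)
    ultimately show "?f x = ennreal ?r" by simp
  qed
  have "Limsup at_infinity ?f \<le> ennreal (U N)" for N
  proof (rule Limsup_bounded)
    \<comment> \<open>The summand 1 forces \<open>\<bar>x\<bar> > 1\<close>, so that a scale
      \<open>n\<close> exists, and makes \<open>b ^ N < b ^ Suc n\<close> strict, whence
      \<open>N \<le> Suc n\<close>.\<close>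
    have "?f x \<le> ennreal (U N)" if x: "b ^ N + 1 \<le> \<bar>x\<bar>" for x
    proof -
      have "b ^ N > 0" using b by simp
      then have x1: "\<bar>x\<bar> > 1" using x by linarith
      then obtain n where n: "b ^ n < \<bar>x\<bar>" "\<bar>x\<bar> \<le> b ^ Suc n"
        using ex_power_interval[of b "\<bar>x\<bar>"] b by auto
      have "b ^ N < b ^ Suc n" using x n(2) by linarith
      then have "N \<le> Suc n" using b by (simp add: power_strict_increasing_iff del: power_Suc)
      then have eN: "\<bar>e\<bar> ^ Suc n \<le> \<bar>e\<bar> ^ N" using e by (intro power_decreasing) auto
      have bx: "b ^ Suc n \<le> b * \<bar>x\<bar>" using n(1) b by simp
      have "c * (b ^ Suc n - 1) + (1 - sgn x * e ^ Suc n) * (d * b ^ Suc n)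
          \<le> c * (b * \<bar>x\<bar>) + (1 + \<bar>e\<bar> ^ N) * (d * (b * \<bar>x\<bar>))"
      proof (intro add_mono mult_mono[of "1 - _"] mult_left_mono)
        show "1 - sgn x * e ^ Suc n \<le> 1 + \<bar>e\<bar> ^ N" using r(2)[OF n] eN by linarith
        show "0 \<le> d * b ^ Suc n" using cd b by simp
      qed (use bx cd in auto)
      also have "\<dots> = (c * b + (1 + \<bar>e\<bar> ^ N) * (d * b)) * \<bar>x\<bar>"
        by (simp add: algebra_simps)
      finally have "(c * (b ^ Suc n - 1) + (1 - sgn x * e ^ Suc n) * (d * b ^ Suc n)) / \<bar>x\<bar>
          \<le> c * b + (1 + \<bar>e\<bar> ^ N) * (d * b)"
        using x1 by (simp add: pos_divide_le_eq)
      then show ?thesis unfolding f[OF n] U_def by (intro ennreal_leI) linarith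
    qed
    then show "\<forall>\<^sub>F x in at_infinity. ?f x \<le> ennreal (U N)"
      unfolding eventually_at_infinity by (intro exI[of _ "b ^ N + 1"]) auto
  qed
  moreover have "(\<lambda>N. ennreal (U N)) \<longlonglongrightarrow> ennreal ?L"
    unfolding U_def L using e by (intro tendsto_intros LIMSEQ_realpow_zero) auto
  ultimately show "competitive_ratio p (zigzag b) \<le> ennreal ?L"
    unfolding competitive_ratio_def by (intro LIMSEQ_le_const) auto

  \<comment> \<open>Positive targets above \<open>b ^ n\<close> whose relative excess tends to 0;
    the excess is at most 1, so \<open>b \<ge> 2\<close> keeps them within
    \<open>b ^ Suc n\<close>.\<close>
  define X where "X n = b ^ n * (1 + inverse (real (Suc n)))" for n
  have X: "b ^ n < \<bar>X n\<bar>" "\<bar>X n\<bar> \<le> b ^ Suc n" "sgn (X n) = 1" for n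
  proof -
    have pos: "b ^ n > 0" "0 < inverse (real (Suc n))" "inverse (real (Suc n)) \<le> 1"
      using b by (auto simp: field_simps)
    moreover from this have "b ^ n * (1 + inverse (real (Suc n))) \<le> b ^ n * b"
      using b by (intro mult_left_mono) auto
    ultimately have "b ^ n < X n" "X n \<le> b ^ Suc n"
      by (auto simp: X_def mult.commute)
    with pos(1) show "b ^ n < \<bar>X n\<bar>" "\<bar>X n\<bar> \<le> b ^ Suc n" "sgn (X n) = 1"
      by (auto simp del: power_Suc)
  qed
  have "?f (X n) = ennreal (1 + (c * (b - inverse b ^ n) + (1 - e ^ Suc n) * (d * b)) /
      (1 + inverse (real (Suc n))))" for n
  proof -
    have "c * (b ^ Suc n - 1) + (1 - e ^ Suc n) * (d * b ^ Suc n) =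
        b ^ n * (c * (b - inverse b ^ n) + (1 - e ^ Suc n) * (d * b))"
      using b by (simp add: field_simps)
    moreover have "\<bar>X n\<bar> = X n" using X(3)[of n] by (simp add: sgn_if split: if_splits)
    ultimately show ?thesis
      using b unfolding f[OF X(1,2)] X(3) by (simp add: X_def del: power_Suc)
  qed
  moreover have "(\<lambda>n. ennreal (1 + (c * (b - inverse b ^ n) + (1 - e ^ Suc n) * (d * b)) /
      (1 + inverse (real (Suc n))))) \<longlonglongrightarrow>
      ennreal (1 + (c * (b - 0) + (1 - 0) * (d * b)) / (1 + 0))"
    using e b
    by (intro tendsto_intros LIMSEQ_inverse_real_of_nat LIMSEQ_realpow_zero
        LIMSEQ_Suc[OF LIMSEQ_power_zero]) (auto simp: field_simps)
  ultimately have lim: "(\<lambda>n. ?f (X n)) \<longlonglongrightarrow> ennreal ?L"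
    unfolding L by (simp add: algebra_simps)
  have "filterlim X at_infinity sequentially"
  proof (rule filterlim_norm_at_top_imp_at_infinity)
    have "filterlim (\<lambda>n. norm (b ^ n)) at_top sequentially"
      using b by (intro filterlim_at_infinity_imp_norm_at_top filterlim_realpow_sequentially_gt1) simp
    then show "filterlim (\<lambda>n. norm (X n)) at_top sequentially"
      by (rule filterlim_at_top_mono) (use X(1) b in \<open>auto intro!: always_eventually less_imp_le\<close>)
  qed
  then have ev: "\<forall>\<^sub>F n in sequentially. P (X n)" if "eventually P at_infinity" for P
    using that by (auto simp: filterlim_iff)
  \<comment> \<open>The limit superior at infinity is an infimum of suprema over eventual sets, and
    the sequence \<open>X\<close> eventually enters each of them.\<close>
  have "Limsup sequentially (\<lambda>n. ?f (X n)) \<le> (SUP x\<in>Collect P. ?f x)"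
    if "eventually P at_infinity" for P
    by (rule Limsup_bounded, rule eventually_mono[OF ev[OF that]]) (rule SUP_upper, simp)
  then show "ennreal ?L \<le> competitive_ratio p (zigzag b)"
    unfolding competitive_ratio_def using lim_imp_Limsup[OF _ lim] by (intro Limsup_greatest) simp
qed

section \<open>The choice of the expansion factor\<close>

theorem theorem2:
  fixes p :: real
  assumes "0 < p" and "p < 1/2"
  shows "\<exists>A. admissible A \<and>
           competitive_ratio p A =
             ennreal (if p \<le> (1/4) * (2 - sqrt 2) then 2 * (sqrt 2 + 2)
                      else 6 - 4 * p + 1 / (1 - 2 * p))"
proof (cases "p \<le> (1/4) * (2 - sqrt 2)")
  case True
  \<comment> \<open>The unconstrained minimiser; \<open>b\<close> comes from solving
    \<open>v = (1 - p) / (b - 1)\<close>.\<close>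
  define v where "v = p + sqrt 2 / 2"
  define b where "b = 1 + (1 - p) / v"
  \<comment> \<open>The case assumption is exactly \<open>v \<le> 1 - p\<close>, which yields
    \<open>b \<ge> 2\<close>; \<open>v > p\<close> yields \<open>p * b < 1\<close>.\<close>
  have v: "v > p" "v \<le> 1 - p" using True by (auto simp: v_def)
  then have "v > 0" using assms by linarith
  note v = v this
  have b: "b \<ge> 2" using v by (simp add: b_def)
  have pb: "1 - p * b = (1 - p) * (v - p) / v"
    using v by (simp add: b_def field_simps)
  have "p * b < 1"
  proof -
    have "(1 - p) * (v - p) / v > 0" using v assms by simp
    then show ?thesis using pb by linarith
  qed
  \<comment> \<open>In terms of \<open>v\<close> the left-hand side is
    \<open>2 * (v + 1 - p)\<close>.\<close>
  moreover have "2 * (1 - p) * b / (b - 1) = 2 + sqrt 2"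
    using v assms by (simp add: b_def field_simps) (simp add: v_def algebra_simps)
  moreover have "(1 - p) * b / (1 - p * b) = 1 + sqrt 2"
  proof -
    have "(1 - p) * b / (1 - p * b) = (v + 1 - p) / (v - p)"
    proof -
      have "b * v = v + 1 - p" using v by (simp add: b_def field_simps)
      moreover have "(1 - p) * b / ((1 - p) * (v - p) / v) = b * v / (v - p)"
        using v assms by simp
      ultimately show ?thesis unfolding pb by simp
    qed
    also have "\<dots> = 1 + sqrt 2" by (simp add: v_def field_simps)
    finally show ?thesis .
  qed
  ultimately show ?thesis
    using True b assms admissible_zigzag[of b] competitive_ratio_zigzag[of p b]
    by (intro exI[of _ "zigzag b"]) (simp add: algebra_simps)
next
  case False
  \<comment> \<open>Beyond the threshold the constraint \<open>b \<ge> 2\<close> binds, hence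
    \<open>b = 2\<close>; then \<open>p * b < 1\<close> is the assumption
    \<open>p < 1/2\<close>.\<close>
  have "competitive_ratio p (zigzag 2) = ennreal (6 - 4 * p + 1 / (1 - 2 * p))"
  proof -
    have "6 - 4 * p + 1 / (1 - 2 * p) =
        1 + 2 * (1 - p) * 2 / (2 - 1) + (1 - p) * 2 / (1 - p * 2)"
      using assms by (simp add: field_simps)
    then show ?thesis
      using assms by (simp only:) (rule competitive_ratio_zigzag; simp)
  qed
  then show ?thesis
    using False admissible_zigzag[of 2] by (intro exI[of _ "zigzag 2"]) (simp del: ennreal_plus)
qed

end
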